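(* Let $P$ be a finite poset of height $h=h(P)$. The Möbius function $\mu$ of $P$ satisfies, in the incidence algebra $\mathrm{Inc}(P)$, for all $x\le y$ in $P$, $$\mu(x,y)=\sum_{k=0}^{h(x,y)}(-1)^k\,\eta^k(x,y),$$ where $h(x,y)=h([x,y])$ is the height of the interval $[x,y]$, and the sum ends exactly at $k=h(x,y)$.
   Context: The incidence algebra $\mathrm{Inc}(P)$ is the space of functions $f:\{(x,y)\in P^2: x\le y\}\to\mathbb{C}$ with convolution $(f*g)(x,y)=\sum_{x\le z\le y}f(x,z)g(z,y)$. The zeta function is $\zeta(x,y)=1$ for all $x\le y$; the identity is $\varepsilon(x,y)=\mathbf{1}[x=y]$; the Möbius function is $\mu=\zeta^{-1}$; and $\eta=\zeta-\varepsilon$, i.e. $\eta(x,y)=\mathbf{1}[x<y]$. Powers $\eta^k$ are convolution powers, $\eta^0=\varepsilon$. The height of a finite poset $Q$ is $h(Q)=\max\{k:\exists\,x_0<x_1<\cdots<x_k\text{ in }Q\}$. *)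

theory Defs
  imports Complex_Main "HOL-Algebra.Ring"
begin

text \<open>
  A finite poset is a finite subset P of an ordered type, with the induced order.
  A whole finite type is covered by taking P to be the universe.
\<close>

definition le_pairs :: "'a::order set \<Rightarrow> ('a \<times> 'a) set" where
  "le_pairs P = {(x, y). x \<in> P \<and> y \<in> P \<and> x \<le> y}"

definition interval_in :: "'a::order set \<Rightarrow> 'a \<Rightarrow> 'a \<Rightarrow> 'a set" where
  "interval_in P x y = P \<inter> {x..y}"

text \<open>
  Only the ring structure is recorded. A function with domain \<^term>\<open>le_pairs P\<close> is an
  extensional function, so that equality in the ring is equality on that domain.
\<close>

definition Inc :: "'a::order set \<Rightarrow> ('a \<times> 'a \<Rightarrow> complex) ring" where
  "Inc P = \<lparr>
     carrier = le_pairs P \<rightarrow>\<^sub>E UNIV,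
     mult = (\<lambda>f g. \<lambda>(x, y)\<in>le_pairs P. \<Sum>z\<in>interval_in P x y. f (x, z) * g (z, y)),
     one = (\<lambda>(x, y)\<in>le_pairs P. if x = y then 1 else 0),
     zero = (\<lambda>p\<in>le_pairs P. 0),
     add = (\<lambda>f g. \<lambda>p\<in>le_pairs P. f p + g p)\<rparr>"

definition zeta :: "'a::order set \<Rightarrow> 'a \<times> 'a \<Rightarrow> complex" where
  "zeta P = (\<lambda>p\<in>le_pairs P. 1)"

definition moebius :: "'a::order set \<Rightarrow> 'a \<times> 'a \<Rightarrow> complex" where
  "moebius P = inv\<^bsub>Inc P\<^esub> (zeta P)"

definition eta :: "'a::order set \<Rightarrow> 'a \<times> 'a \<Rightarrow> complex" where
  "eta P = zeta P \<ominus>\<^bsub>Inc P\<^esub> \<one>\<^bsub>Inc P\<^esub>"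

text \<open>The maximum exists only for finite nonempty \<open>Q\<close>.\<close>

definition height :: "'a::order set \<Rightarrow> nat" where
  "height Q = Max {k. \<exists>c :: nat \<Rightarrow> 'a. (\<forall>i\<le>k. c i \<in> Q) \<and> (\<forall>i<k. c i < c (Suc i))}"

lemma ring_Inc:
  fixes P :: "'a::order set"
  assumes "finite P"
  shows "ring (Inc P)"
proof (rule ringI)
  have fin: "finite (interval_in P x y)" for x y
    using assms by (simp add: interval_in_def)
  show "abelian_group (Inc P)"
  proof (rule abelian_groupI)
    fix f assume f: "f \<in> carrier (Inc P)"
    show "\<exists>g\<in>carrier (Inc P). g \<oplus>\<^bsub>Inc P\<^esub> f = \<zero>\<^bsub>Inc P\<^esub>"
      by (rule bexI[of _ "\<lambda>p\<in>le_pairs P. - f p"]) (auto simp: Inc_def restrict_def fun_eq_iff)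
    show "\<zero>\<^bsub>Inc P\<^esub> \<oplus>\<^bsub>Inc P\<^esub> f = f"
      using f by (auto simp: Inc_def restrict_def fun_eq_iff PiE_def extensional_def)
  qed (auto simp: Inc_def restrict_def fun_eq_iff PiE_def extensional_def algebra_simps)
  show "Group.monoid (Inc P)"
  proof (rule monoidI)
    fix f g h assume "f \<in> carrier (Inc P)" "g \<in> carrier (Inc P)" "h \<in> carrier (Inc P)"
    show "f \<otimes>\<^bsub>Inc P\<^esub> g \<otimes>\<^bsub>Inc P\<^esub> h = f \<otimes>\<^bsub>Inc P\<^esub> (g \<otimes>\<^bsub>Inc P\<^esub> h)"
    proof
      fix p :: "'a \<times> 'a"
      obtain x y where p: "p = (x, y)" by fastforce
      show "(f \<otimes>\<^bsub>Inc P\<^esub> g \<otimes>\<^bsub>Inc P\<^esub> h) p = (f \<otimes>\<^bsub>Inc P\<^esub> (g \<otimes>\<^bsub>Inc P\<^esub> h)) p"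
      proof (cases "p \<in> le_pairs P")
        case True
        have "(f \<otimes>\<^bsub>Inc P\<^esub> g \<otimes>\<^bsub>Inc P\<^esub> h) p =
            (\<Sum>z\<in>interval_in P x y. \<Sum>w\<in>interval_in P x z. f (x, w) * g (w, z) * h (z, y))"
          using True by (auto simp: p Inc_def le_pairs_def interval_in_def sum_distrib_right intro!: sum.cong)
        also have "\<dots> = (\<Sum>z\<in>interval_in P x y. \<Sum>w\<in>interval_in P x y.
            if w \<le> z then f (x, w) * g (w, z) * h (z, y) else 0)"
          using fin by (intro sum.cong refl sum.mono_neutral_cong_left) (auto simp: interval_in_def)
        also have "\<dots> = (\<Sum>w\<in>interval_in P x y. \<Sum>z\<in>interval_in P x y.
            if w \<le> z then f (x, w) * g (w, z) * h (z, y) else 0)"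
          by (rule sum.swap)
        also have "\<dots> = (\<Sum>w\<in>interval_in P x y. \<Sum>z\<in>interval_in P w y. f (x, w) * g (w, z) * h (z, y))"
          using fin by (intro sum.cong refl sum.mono_neutral_cong_right) (auto simp: interval_in_def)
        also have "\<dots> = (f \<otimes>\<^bsub>Inc P\<^esub> (g \<otimes>\<^bsub>Inc P\<^esub> h)) p"
          using True by (auto simp: p Inc_def le_pairs_def interval_in_def sum_distrib_left mult.assoc intro!: sum.cong)
        finally show ?thesis .
      qed (simp add: Inc_def)
    qed
  next
    fix f assume f: "f \<in> carrier (Inc P)"
    show "\<one>\<^bsub>Inc P\<^esub> \<otimes>\<^bsub>Inc P\<^esub> f = f"
    proof
      fix p :: "'a \<times> 'a"
      obtain x y where p: "p = (x, y)" by fastforce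
      show "(\<one>\<^bsub>Inc P\<^esub> \<otimes>\<^bsub>Inc P\<^esub> f) p = f p"
      proof (cases "p \<in> le_pairs P")
        case True
        have "(\<one>\<^bsub>Inc P\<^esub> \<otimes>\<^bsub>Inc P\<^esub> f) p = (\<Sum>z\<in>interval_in P x y. if x = z then f (z, y) else 0)"
          using True by (auto simp: p Inc_def le_pairs_def interval_in_def intro!: sum.cong)
        also have "\<dots> = f p" using True fin by (simp add: p) (auto simp: le_pairs_def interval_in_def)
        finally show ?thesis .
      next
        case False
        then show ?thesis using f by (auto simp: p Inc_def PiE_def extensional_def)
      qed
    qed
    show "f \<otimes>\<^bsub>Inc P\<^esub> \<one>\<^bsub>Inc P\<^esub> = f"
    proof
      fix p :: "'a \<times> 'a"
      obtain x y where p: "p = (x, y)" by fastforce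
      show "(f \<otimes>\<^bsub>Inc P\<^esub> \<one>\<^bsub>Inc P\<^esub>) p = f p"
      proof (cases "p \<in> le_pairs P")
        case True
        have "(f \<otimes>\<^bsub>Inc P\<^esub> \<one>\<^bsub>Inc P\<^esub>) p = (\<Sum>z\<in>interval_in P x y. if z = y then f (x, z) else 0)"
          using True by (auto simp: p Inc_def le_pairs_def interval_in_def intro!: sum.cong)
        also have "\<dots> = f p" using True fin by (simp add: p) (auto simp: le_pairs_def interval_in_def)
        finally show ?thesis .
      next
        case False
        then show ?thesis using f by (auto simp: p Inc_def PiE_def extensional_def)
      qed
    qed
  qed (auto simp: Inc_def)
  fix f g h assume "f \<in> carrier (Inc P)" "g \<in> carrier (Inc P)" "h \<in> carrier (Inc P)"
  show "(f \<oplus>\<^bsub>Inc P\<^esub> g) \<otimes>\<^bsub>Inc P\<^esub> h = f \<otimes>\<^bsub>Inc P\<^esub> h \<oplus>\<^bsub>Inc P\<^esub> g \<otimes>\<^bsub>Inc P\<^esub> h"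
    by (auto simp: Inc_def fun_eq_iff restrict_def le_pairs_def interval_in_def
        distrib_right sum.distrib[symmetric] intro!: sum.cong)
  show "h \<otimes>\<^bsub>Inc P\<^esub> (f \<oplus>\<^bsub>Inc P\<^esub> g) = h \<otimes>\<^bsub>Inc P\<^esub> f \<oplus>\<^bsub>Inc P\<^esub> h \<otimes>\<^bsub>Inc P\<^esub> g"
    by (auto simp: Inc_def fun_eq_iff restrict_def le_pairs_def interval_in_def
        distrib_left sum.distrib[symmetric] intro!: sum.cong)
qed

lemma eta_apply:
  assumes "finite P" "x \<in> P" "y \<in> P" "x \<le> y"
  shows "eta P (x, y) = (if x < y then 1 else 0)"
proof -
  interpret ring "Inc P" by (rule ring_Inc) fact
  have xy: "(x, y) \<in> le_pairs P" using assms by (simp add: le_pairs_def)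
  define e where "e = (\<lambda>(x, y)\<in>le_pairs P. if x < y then 1 else 0 :: complex)"
  have e: "e \<in> carrier (Inc P)" by (auto simp: e_def Inc_def)
  have "e \<oplus>\<^bsub>Inc P\<^esub> \<one>\<^bsub>Inc P\<^esub> = zeta P"
    by (auto simp: e_def zeta_def Inc_def fun_eq_iff restrict_def le_pairs_def)
  then have "eta P = e"
    using e by (metis eta_def a_minus_def a_assoc a_inv_closed one_closed r_neg r_zero)
  then show ?thesis using xy by (simp add: e_def)
qed

end

theory Submission imports Defs begin

text \<open>
  The entry \<open>\<eta>\<^sup>k(x, y)\<close> counts the chains \<open>x = c\<^sub>0 < c\<^sub>1 < \<dots> < c\<^sub>k = y\<close>: convolution with \<open>\<eta>\<close>
  appends one strict step (\<open>eta_pow_apply\<close>). Two consequences give the theorem.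

  First, the entry vanishes for every \<open>k\<close> above the height of the interval \<open>[x, y]\<close>, and it is nonzero
  at the height itself: a chain of maximal length in \<open>[x, y]\<close> has to start in \<open>x\<close> and
  end in \<open>y\<close>, since otherwise an endpoint could be added to it (\<open>longest_chain_in_interval\<close>).

  Secondly, all chains of \<open>P\<close> have length at most the height of \<open>P\<close>, so \<open>\<eta>\<close> is nilpotent. Hence
  \<open>\<zeta> = \<epsilon> + \<eta>\<close> is inverted by a finite geometric sum, a fact about arbitrary rings
  (\<open>inv_one_minus_nilpotent\<close>). At \<open>(x, y)\<close> that sum may be cut at the height of \<open>[x, y]\<close>, because the
  later terms vanish there.
\<close>

section \<open>Chains and height\<close>

definition is_chain :: "'a::order set \<Rightarrow> nat \<Rightarrow> (nat \<Rightarrow> 'a) \<Rightarrow> bool" where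
  "is_chain Q k c \<longleftrightarrow> (\<forall>i\<le>k. c i \<in> Q) \<and> (\<forall>i<k. c i < c (Suc i))"

lemma is_chain_less:
  assumes "is_chain Q k c" "i < j" "j \<le> k"
  shows "c i < c j"
  using assms(2,3)
proof (induction j)
  case (Suc j)
  have "c j < c (Suc j)"
    using assms(1) Suc.prems by (simp add: is_chain_def)
  with Suc show ?case
    by (cases "i = j") (auto intro: less_trans)
qed simp

lemma is_chain_length:
  assumes "finite Q" "is_chain Q k c"
  shows "k < card Q"
proof -
  have "inj_on c {..k}"
    by (rule linorder_inj_onI) (use is_chain_less[OF assms(2)] in fastforce)+
  moreover have "c ` {..k} \<subseteq> Q"
    using assms(2) by (auto simp: is_chain_def)
  ultimately have "card {..k} \<le> card Q"
    using assms(1) by (rule card_inj_on_le)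
  then show ?thesis by simp
qed

lemma height_eq_Max: "height Q = Max {k. \<exists>c. is_chain Q k c}"
  by (simp add: height_def is_chain_def)

lemma finite_chain_lengths:
  assumes "finite Q"
  shows "finite {k. \<exists>c. is_chain Q k c}"
  by (rule finite_subset[of _ "{..<card Q}"]) (use is_chain_length[OF assms] in auto)

lemma is_chain_le_height:
  assumes "finite Q" "is_chain Q k c"
  shows "k \<le> height Q"
  unfolding height_eq_Max using assms by (intro Max_ge finite_chain_lengths) auto

lemma height_attained:
  assumes "finite Q" "Q \<noteq> {}"
  obtains c where "is_chain Q (height Q) c"
proof -
  obtain q where "q \<in> Q" using assms(2) by blast
  then have "is_chain Q 0 (\<lambda>_. q)" by (simp add: is_chain_def)
  then have "height Q \<in> {k. \<exists>c. is_chain Q k c}"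
    unfolding height_eq_Max using assms(1) by (intro Max_in finite_chain_lengths) auto
  then show thesis using that by blast
qed

lemma is_chain_snoc:
  assumes "is_chain Q k c" "z \<in> Q" "c k < z"
  shows "is_chain Q (Suc k) (c(Suc k := z))"
  using assms by (auto simp: is_chain_def less_Suc_eq le_Suc_eq)

lemma is_chain_Cons:
  assumes "is_chain Q k c" "z \<in> Q" "z < c 0"
  shows "is_chain Q (Suc k) (case_nat z c)"
  using assms by (auto simp: is_chain_def split: nat.splits)

text \<open>A chain that misses an endpoint of the interval can be prolonged by that endpoint.\<close>

lemma longest_chain_in_interval:
  assumes "finite P" "x \<in> P" "y \<in> P" "x \<le> y"
  obtains c where "is_chain (interval_in P x y) (height (interval_in P x y)) c"
    "c 0 = x" "c (height (interval_in P x y)) = y"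
proof -
  let ?I = "interval_in P x y" and ?h = "height (interval_in P x y)"
  have fin: "finite ?I" and x: "x \<in> ?I" and y: "y \<in> ?I"
    using assms by (auto simp: interval_in_def)
  obtain c where c: "is_chain ?I ?h c"
    using height_attained[OF fin] x by blast
  then have le: "x \<le> c 0" "c ?h \<le> y"
    by (auto simp: is_chain_def interval_in_def)
  have "\<not> x < c 0"
    using is_chain_le_height[OF fin is_chain_Cons[OF c x]] by auto
  moreover have "\<not> c ?h < y"
    using is_chain_le_height[OF fin is_chain_snoc[OF c y]] by auto
  ultimately show thesis using that c le by (simp add: order.strict_iff_order)
qed

section \<open>Powers of eta count chains\<close>

text \<open>
  The recursion, on the last element \<open>z\<close> before \<open>y\<close>, mirrors the convolution of \<open>\<eta>\<^sup>k\<close> with \<open>\<eta>\<close>.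
\<close>

fun chain_count :: "'a::order set \<Rightarrow> 'a \<Rightarrow> nat \<Rightarrow> 'a \<Rightarrow> nat" where
  "chain_count P x 0 y = (if x = y then 1 else 0)"
| "chain_count P x (Suc k) y = (\<Sum>z | z \<in> P \<and> x \<le> z \<and> z < y. chain_count P x k z)"

lemma chain_count_pos_iff:
  assumes "finite P" "x \<in> P" "y \<in> P" "x \<le> y"
  shows "0 < chain_count P x k y \<longleftrightarrow> (\<exists>c. is_chain (interval_in P x y) k c \<and> c 0 = x \<and> c k = y)"
  using assms(3,4)
proof (induction k arbitrary: y)
  case 0
  then show ?case
    using assms(2) by (auto simp: is_chain_def interval_in_def intro!: exI[of _ "\<lambda>_. y"])
next
  case (Suc k)
  have "0 < chain_count P x (Suc k) y \<longleftrightarrow>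
      (\<exists>z. z \<in> P \<and> x \<le> z \<and> z < y \<and> 0 < chain_count P x k z)"
    unfolding zero_less_iff_neq_zero using assms(1) by (auto simp del: neq0_conv)
  also have "\<dots> \<longleftrightarrow> (\<exists>z c. z \<in> P \<and> x \<le> z \<and> z < y \<and> is_chain (interval_in P x z) k c \<and> c 0 = x \<and> c k = z)"
    using Suc.IH by blast
  also have "\<dots> \<longleftrightarrow> (\<exists>c. is_chain (interval_in P x y) (Suc k) c \<and> c 0 = x \<and> c (Suc k) = y)"
  proof (intro iffI; elim exE conjE)
    fix z c
    assume z: "z \<in> P" "x \<le> z" "z < y"
      and c: "is_chain (interval_in P x z) k c" "c 0 = x" "c k = z"
    have "is_chain (interval_in P x y) k c"
      using c(1) z(3) by (auto simp: is_chain_def interval_in_def intro: order.trans)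
    then have "is_chain (interval_in P x y) (Suc k) (c(Suc k := y))"
      using Suc.prems z(3) c(3) by (intro is_chain_snoc) (auto simp: interval_in_def)
    then show "\<exists>c. is_chain (interval_in P x y) (Suc k) c \<and> c 0 = x \<and> c (Suc k) = y"
      using c(2) by (intro exI[of _ "c(Suc k := y)"]) simp
  next
    fix c
    assume c: "is_chain (interval_in P x y) (Suc k) c" "c 0 = x" "c (Suc k) = y"
    \<comment> \<open>Without its last element the chain stays below \<open>c k\<close>, so it lies in the smaller interval.\<close>
    have "c i \<le> c k" if "i \<le> k" for i
      using is_chain_less[OF c(1), of i k] that by (cases "i = k") auto
    then have "is_chain (interval_in P x (c k)) k c"
      using c(1) by (auto simp: is_chain_def interval_in_def)
    moreover have "c k \<in> P" "x \<le> c k" "c k < y"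
      using c by (auto simp: is_chain_def interval_in_def)
    ultimately show "\<exists>z c. z \<in> P \<and> x \<le> z \<and> z < y \<and> is_chain (interval_in P x z) k c \<and> c 0 = x \<and> c k = z"
      using c(2) by blast
  qed
  finally show ?case .
qed

lemma eta_pow_apply:
  assumes "finite P" "x \<in> P" "y \<in> P" "x \<le> y"
  shows "(eta P [^]\<^bsub>Inc P\<^esub> k) (x, y) = of_nat (chain_count P x k y)"
  using assms(3,4)
proof (induction k arbitrary: y)
  case 0
  then show ?case
    using assms(2) by (simp add: nat_pow_def Inc_def le_pairs_def)
next
  case (Suc k)
  have "(eta P [^]\<^bsub>Inc P\<^esub> Suc k) (x, y) =
      (\<Sum>z\<in>interval_in P x y. (eta P [^]\<^bsub>Inc P\<^esub> k) (x, z) * eta P (z, y))"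
    using Suc.prems assms(2) by (simp add: nat_pow_def Inc_def le_pairs_def)
  also have "\<dots> = (\<Sum>z | z \<in> P \<and> x \<le> z \<and> z < y. of_nat (chain_count P x k z))"
    using assms(1) Suc.prems
    by (intro sum.mono_neutral_cong_right)
      (auto simp: interval_in_def eta_apply Suc.IH order.strict_iff_order)
  finally show ?case by simp
qed

lemma eta_pow_eq_0:
  assumes "finite P" "x \<in> P" "y \<in> P" "x \<le> y" "height (interval_in P x y) < k"
  shows "(eta P [^]\<^bsub>Inc P\<^esub> k) (x, y) = 0"
proof -
  have "finite (interval_in P x y)"
    using assms(1) by (simp add: interval_in_def)
  then have "\<not> is_chain (interval_in P x y) k c" for c
    using is_chain_le_height[of "interval_in P x y" k c] assms(5) by auto
  then have "\<not> 0 < chain_count P x k y"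
    using chain_count_pos_iff[OF assms(1-4)] by simp
  then show ?thesis
    using eta_pow_apply[OF assms(1-4)] by simp
qed

lemma height_interval_le:
  assumes "finite P" "x \<in> P" "y \<in> P" "x \<le> y"
  shows "height (interval_in P x y) \<le> height P"
proof -
  obtain c where "is_chain (interval_in P x y) (height (interval_in P x y)) c"
    using longest_chain_in_interval[OF assms] by blast
  then have "is_chain P (height (interval_in P x y)) c"
    by (auto simp: is_chain_def interval_in_def)
  then show ?thesis
    using assms(1) by (rule is_chain_le_height[rotated])
qed

section \<open>Inverting zeta by a geometric sum\<close>

text \<open>
  Multiplying out telescopes. Both orders of the factors are needed, because the incidence algebra is
  not commutative and its inverse is two-sided.
\<close>

lemma (in ring) geometric_sum:
  assumes "a \<in> carrier R"
  shows "(\<one> \<ominus> a) \<otimes> (\<Oplus>k\<in>{..<n::nat}. a [^] k) = \<one> \<ominus> a [^] n"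
    and "(\<Oplus>k\<in>{..<n::nat}. a [^] k) \<otimes> (\<one> \<ominus> a) = \<one> \<ominus> a [^] n"
proof -
  have pow: "a [^] k \<in> carrier R" for k :: nat
    using assms by simp
  have sum: "(\<Oplus>k\<in>{..<n::nat}. a [^] k) \<in> carrier R" for n
    using pow by (intro finsum_closed) auto
  have split: "(\<Oplus>k\<in>{..<Suc n}. a [^] k) = a [^] n \<oplus> (\<Oplus>k\<in>{..<n}. a [^] k)" for n :: nat
    using pow by (simp add: lessThan_Suc)
  have telescope: "(u \<ominus> v) \<oplus> (\<one> \<ominus> u) = \<one> \<ominus> v" if "u \<in> carrier R" "v \<in> carrier R" for u v
    using that by algebra
  show "(\<one> \<ominus> a) \<otimes> (\<Oplus>k\<in>{..<n::nat}. a [^] k) = \<one> \<ominus> a [^] n"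
  proof (induction n)
    case (Suc n)
    have "(\<one> \<ominus> a) \<otimes> a [^] n = a [^] n \<ominus> a [^] Suc n"
      unfolding nat_pow_Suc2[OF assms] using assms by (simp add: a_minus_def l_distr l_minus)
    moreover have "(\<one> \<ominus> a) \<otimes> (\<Oplus>k\<in>{..<Suc n}. a [^] k) =
        (\<one> \<ominus> a) \<otimes> a [^] n \<oplus> (\<one> \<ominus> a) \<otimes> (\<Oplus>k\<in>{..<n}. a [^] k)"
      unfolding split using assms pow sum by (intro r_distr) auto
    ultimately show ?case
      using telescope[OF pow pow] Suc.IH by metis
  qed (use assms in \<open>simp add: r_neg a_minus_def\<close>)
  show "(\<Oplus>k\<in>{..<n::nat}. a [^] k) \<otimes> (\<one> \<ominus> a) = \<one> \<ominus> a [^] n"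
  proof (induction n)
    case (Suc n)
    have "a [^] n \<otimes> (\<one> \<ominus> a) = a [^] n \<ominus> a [^] Suc n"
      using assms by (simp add: a_minus_def r_distr r_minus)
    moreover have "(\<Oplus>k\<in>{..<Suc n}. a [^] k) \<otimes> (\<one> \<ominus> a) =
        a [^] n \<otimes> (\<one> \<ominus> a) \<oplus> (\<Oplus>k\<in>{..<n}. a [^] k) \<otimes> (\<one> \<ominus> a)"
      unfolding split using assms pow sum by (intro l_distr) auto
    ultimately show ?case
      using telescope[OF pow pow] Suc.IH by metis
  qed (use assms in \<open>simp add: r_neg a_minus_def\<close>)
qed

lemma (in ring) inv_one_minus_nilpotent:
  assumes "a \<in> carrier R" "a [^] (n::nat) = \<zero>"
  shows "inv (\<one> \<ominus> a) = (\<Oplus>k\<in>{..<n}. a [^] k)"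
  using assms geometric_sum[of a n] by (intro inv_char finsum_closed) (auto simp: a_minus_def)

lemma Inc_uminus_apply:
  assumes "finite P" "f \<in> carrier (Inc P)" "p \<in> le_pairs P"
  shows "(\<ominus>\<^bsub>Inc P\<^esub> f) p = - f p"
proof -
  interpret ring "Inc P" by (rule ring_Inc) fact
  have "(\<ominus>\<^bsub>Inc P\<^esub> f \<oplus>\<^bsub>Inc P\<^esub> f) p = \<zero>\<^bsub>Inc P\<^esub> p"
    using assms(2) by (simp add: l_neg)
  then show ?thesis
    using assms(3) by (simp add: Inc_def add_eq_0_iff)
qed

lemma Inc_finsum_apply:
  assumes "finite P" "finite A" "f \<in> A \<rightarrow> carrier (Inc P)" "p \<in> le_pairs P"
  shows "(\<Oplus>\<^bsub>Inc P\<^esub>k\<in>A. f k) p = (\<Sum>k\<in>A. f k p)"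
proof -
  interpret ring "Inc P" by (rule ring_Inc) fact
  show ?thesis
    using assms(2,3)
  proof (induction A)
    case empty
    then show ?case using assms(4) by (subst finsum_empty) (simp add: Inc_def)
  next
    case (insert a A)
    then have "(\<Oplus>\<^bsub>Inc P\<^esub>k\<in>insert a A. f k) p = (f a \<oplus>\<^bsub>Inc P\<^esub> (\<Oplus>\<^bsub>Inc P\<^esub>k\<in>A. f k)) p"
      by (subst finsum_insert) auto
    also have "\<dots> = f a p + (\<Oplus>\<^bsub>Inc P\<^esub>k\<in>A. f k) p"
      using assms(4) by (simp add: Inc_def)
    finally show ?case using insert by simp
  qed
qed

lemma Inc_uminus_pow_apply:
  assumes "finite P" "f \<in> carrier (Inc P)" "p \<in> le_pairs P"
  shows "((\<ominus>\<^bsub>Inc P\<^esub> f) [^]\<^bsub>Inc P\<^esub> (k::nat)) p = (-1) ^ k * (f [^]\<^bsub>Inc P\<^esub> k) p"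
proof -
  interpret ring "Inc P" by (rule ring_Inc) fact
  show ?thesis
    using assms(3)
  proof (induction k arbitrary: p)
    case (Suc k)
    have "(\<ominus>\<^bsub>Inc P\<^esub> f) [^]\<^bsub>Inc P\<^esub> Suc k =
        \<ominus>\<^bsub>Inc P\<^esub> ((\<ominus>\<^bsub>Inc P\<^esub> f) [^]\<^bsub>Inc P\<^esub> k \<otimes>\<^bsub>Inc P\<^esub> f)"
      using assms(2) by (simp add: r_minus)
    then have "((\<ominus>\<^bsub>Inc P\<^esub> f) [^]\<^bsub>Inc P\<^esub> Suc k) p =
        - (((\<ominus>\<^bsub>Inc P\<^esub> f) [^]\<^bsub>Inc P\<^esub> k \<otimes>\<^bsub>Inc P\<^esub> f) p)"
      using assms(1,2) Suc.prems by (simp add: Inc_uminus_apply)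
    also have "((\<ominus>\<^bsub>Inc P\<^esub> f) [^]\<^bsub>Inc P\<^esub> k \<otimes>\<^bsub>Inc P\<^esub> f) p =
        (-1) ^ k * (f [^]\<^bsub>Inc P\<^esub> k \<otimes>\<^bsub>Inc P\<^esub> f) p"
    proof -
      obtain x y where p: "p = (x, y)" by fastforce
      have mult: "(g \<otimes>\<^bsub>Inc P\<^esub> f) (x, y) = (\<Sum>z\<in>interval_in P x y. g (x, z) * f (z, y))" for g
        using Suc.prems by (simp add: p Inc_def)
      have "(x, z) \<in> le_pairs P" if "z \<in> interval_in P x y" for z
        using that Suc.prems by (auto simp: p le_pairs_def interval_in_def)
      then show ?thesis
        by (simp add: p mult Suc.IH sum_distrib_left mult.assoc)
    qed
    finally show ?case by simp
  qed simp
qed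

lemma eta_closed:
  assumes "finite P"
  shows "eta P \<in> carrier (Inc P)"
proof -
  interpret ring "Inc P" by (rule ring_Inc) fact
  have "zeta P \<in> carrier (Inc P)" by (simp add: zeta_def Inc_def)
  then show ?thesis by (simp add: eta_def)
qed

lemma zeta_eq:
  assumes "finite P"
  shows "zeta P = \<one>\<^bsub>Inc P\<^esub> \<ominus>\<^bsub>Inc P\<^esub> (\<ominus>\<^bsub>Inc P\<^esub> eta P)"
proof -
  interpret ring "Inc P" by (rule ring_Inc) fact
  have "zeta P \<in> carrier (Inc P)" by (simp add: zeta_def Inc_def)
  then show ?thesis
    unfolding eta_def by algebra
qed

text \<open>
  The exponent has to serve all pairs at once, so it comes from the height of \<open>P\<close>, which bounds
  the heights of all intervals.
\<close>

lemma uminus_eta_nilpotent: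
  assumes "finite P"
  shows "(\<ominus>\<^bsub>Inc P\<^esub> eta P) [^]\<^bsub>Inc P\<^esub> Suc (height P) = \<zero>\<^bsub>Inc P\<^esub>" (is "?f = _")
proof -
  interpret ring "Inc P" by (rule ring_Inc) fact
  have "?f \<in> carrier (Inc P)" "\<zero>\<^bsub>Inc P\<^esub> \<in> carrier (Inc P)"
    using eta_closed[OF assms] by (blast intro: nat_pow_closed a_inv_closed zero_closed)+
  then have carrier: "?f \<in> le_pairs P \<rightarrow>\<^sub>E UNIV" "\<zero>\<^bsub>Inc P\<^esub> \<in> le_pairs P \<rightarrow>\<^sub>E UNIV"
    unfolding Inc_def partial_object.select_convs by blast+
  have "?f p = \<zero>\<^bsub>Inc P\<^esub> p" if p: "p \<in> le_pairs P" for p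
  proof -
    obtain x y where xy: "p = (x, y)" by fastforce
    then have "x \<in> P" "y \<in> P" "x \<le> y" using p by (auto simp: le_pairs_def)
    then have "(eta P [^]\<^bsub>Inc P\<^esub> Suc (height P)) p = 0"
      unfolding xy using assms height_interval_le
      by (intro eta_pow_eq_0) (auto simp: less_Suc_eq_le)
    then have "?f p = 0"
      by (subst Inc_uminus_pow_apply[OF assms eta_closed[OF assms] p]) simp
    then show ?thesis using p by (simp add: Inc_def)
  qed
  then show ?thesis
    by (rule PiE_ext[OF carrier])
qed

theorem theoremM2:
  fixes P :: "'a::order set" and h :: nat and x y :: 'a
  assumes "finite P"
    and "h = height P"
    and "x \<in> P" and "y \<in> P" and "x \<le> y"
  shows "moebius P (x, y) =
           (\<Sum>k = 0..height (interval_in P x y). (-1) ^ k * (eta P [^]\<^bsub>Inc P\<^esub> k) (x, y))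
       \<and> (eta P [^]\<^bsub>Inc P\<^esub> height (interval_in P x y)) (x, y) \<noteq> 0
       \<and> (\<forall>k > height (interval_in P x y). (eta P [^]\<^bsub>Inc P\<^esub> k) (x, y) = 0)"
proof (intro conjI)
  let ?h = "height (interval_in P x y)"
  interpret ring "Inc P" by (rule ring_Inc) fact
  note eta = eta_closed[OF assms(1)]
  have xy: "(x, y) \<in> le_pairs P" using assms by (simp add: le_pairs_def)
  show vanish: "\<forall>k > ?h. (eta P [^]\<^bsub>Inc P\<^esub> k) (x, y) = 0"
    using assms by (simp add: eta_pow_eq_0)
  have "0 < chain_count P x ?h y"
    using longest_chain_in_interval[OF assms(1,3-5)] chain_count_pos_iff[OF assms(1,3-5)] by metis
  then show "(eta P [^]\<^bsub>Inc P\<^esub> ?h) (x, y) \<noteq> 0"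
    using assms by (simp add: eta_pow_apply)
  have "moebius P = (\<Oplus>\<^bsub>Inc P\<^esub>k\<in>{..<Suc h}. (\<ominus>\<^bsub>Inc P\<^esub> eta P) [^]\<^bsub>Inc P\<^esub> k)"
    unfolding moebius_def zeta_eq[OF assms(1)] assms(2)
    using eta uminus_eta_nilpotent[OF assms(1)] by (intro inv_one_minus_nilpotent) auto
  then have "moebius P (x, y) = (\<Sum>k<Suc h. ((\<ominus>\<^bsub>Inc P\<^esub> eta P) [^]\<^bsub>Inc P\<^esub> k) (x, y))"
    using eta xy assms(1) by (simp add: Inc_finsum_apply Pi_iff del: lessThan_Suc sum.lessThan_Suc)
  also have "\<dots> = (\<Sum>k<Suc h. (-1) ^ k * (eta P [^]\<^bsub>Inc P\<^esub> k) (x, y))"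
    using Inc_uminus_pow_apply[OF assms(1) eta xy] by simp
  also have "\<dots> = (\<Sum>k = 0..?h. (-1) ^ k * (eta P [^]\<^bsub>Inc P\<^esub> k) (x, y))"
    using vanish height_interval_le[OF assms(1,3-5)] assms(2)
    by (intro sum.mono_neutral_right) auto
  finally show "moebius P (x, y) = (\<Sum>k = 0..?h. (-1) ^ k * (eta P [^]\<^bsub>Inc P\<^esub> k) (x, y))" .
qed

end
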